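(* Let $\mathcal{T},\mathcal{A}\in\Pi_3$, and let $V:L_2\to\mathbb{R}^+$ (nonnegative reals) with $V(0)=0$ be positive semidefinite (i.e. $V(\mathbf{x})\ge0$ for all $\mathbf{x}\in L_2$) and admit a derivative $\dot V$ along solutions of the partial integral equation (PIE) $\mathcal{T}\dot{\mathbf{x}}=\mathcal{A}\mathbf{x}$ (as defined in the context). Then the PIE is: (1) FE PIE to PDE stable if $V$ is PIE bounded and $\dot V$ is PDE negative; (2) FE PIE stable if $V$ is PIE bounded and $\dot V$ is PIE negative; (3) FE PDE stable if $V$ is PDE bounded and $\dot V$ is PDE negative; (4) FE PDE to PIE stable if $V$ is PDE bounded and $\dot V$ is PIE negative.
   Context: $L_2$ denotes the real Hilbert space $L_2([0,1];\mathbb{R}^m)$ with inner product $\langle\cdot,\cdot\rangle$ and norm $\|\cdot\|$. A partial integral (PI) operator is a bounded linear operator $\mathcal{P}:L_2\to L_2$ of the form $(\mathcal{P}\mathbf{x})(s)=R_0(s)\mathbf{x}(s)+\int_0^s R_1(s,\theta)\mathbf{x}(\theta)\,d\theta+\int_s^1R_2(s,\theta)\mathbf{x}(\theta)\,d\theta$ with (matrix-valued) $R_0\in L_\infty$ and $R_1,R_2\in L_2$; $\Pi_3$ is the set of all such operators. A solution of $\mathcal{T}\dot{\mathbf{x}}=\mathcal{A}\mathbf{x}$ is a differentiable function $\mathbf{x}:[0,\infty)\to L_2$ with $\mathcal{T}\dot{\mathbf{x}}(t)=\mathcal{A}\mathbf{x}(t)$ for all $t\ge 0$. (When the PIE comes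 from a classically well-posed PDE, $\mathcal{T}\mathbf{x}(t)$ is the PDE state; this only motivates the terminology.) Derivative along solutions: $V$ is assumed sufficiently regular, meaning that $t\mapsto V(\mathbf{x}(t))$ is continuous for every solution, and that there is a function $\dot V:L_2\to\mathbb{R}$ with $\dot V(\mathbf{x})=\lim_{h\to0^+}\frac{V(\hat{\mathbf{x}}(h))-V(\mathbf{x})}{h}$ for every $\mathbf{x}\in L_2$ and every solution $\hat{\mathbf{x}}$ with $\hat{\mathbf{x}}(0)=\mathbf{x}$. Properties (each inequality for all $\mathbf{x}\in L_2$): $V$ is PIE bounded if $V(\mathbf{x})\le C\|\mathbf{x}\|^2$ for some $C>0$; PDE bounded if $V(\mathbf{x})\le C\|\mathcal{T}\mathbf{x}\|^2$ for some $C>0$. $\dot V$ is PDE negative if $\dot V(\mathbf{x})\le-\alpha\|\mathcal{T}\mathbf{x}\|^2$ for some $\alpha>0$; PIE negative if $\dot V(\mathbf{x})\le-\alpha\|\mathbf{x}\|^2$ for some $\alpha>0$. Finite-energy (FE) stability: the PIE is called - FE PIE to PDE stable if there is $C>0$ such that every solution satisfies $\left(\int_0^\infty\|\mathcal{T}\mathbf{x}(t)\|^2dt\right)^{1/2}\le C\|\mathbf{x}(0)\|$; - FE PIE stable if there is $C>0$ such that every solution satisfies $\left(\int_0^\infty\|\mathbf{x}(t)\|^2dt\right)^{1/2}\le C\|\mathbf{x}(0)\|$; - FE PDE stable if there is $C>0$ such that every solution satisfies $\left(\int_0^\infty\|\mathcal{T}\mathbf{x}(t)\|^2dt\right)^{1/2}\le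 C\|\mathcal{T}\mathbf{x}(0)\|$; - FE PDE to PIE stable if there is $C>0$ such that every solution satisfies $\left(\int_0^\infty\|\mathbf{x}(t)\|^2dt\right)^{1/2}\le C\|\mathcal{T}\mathbf{x}(0)\|$. *)

theory Defs
  imports "HOL-Analysis.Analysis"
begin

abbreviation unit_lborel :: "real measure"
  where "unit_lborel \<equiv> restrict_space lborel {0..1}"

text \<open>
  Representatives are total functions on the reals, but only their values on \<open>{0..1}\<close> matter.
  Every Lebesgue measurable function agrees almost everywhere with a Borel measurable one, so
  working with Borel measurable representatives yields the usual space of equivalence classes.
\<close>

definition square_integrable :: "(real \<Rightarrow> 'b::euclidean_space) \<Rightarrow> bool"
  where "square_integrable f \<longleftrightarrow>
    f \<in> borel_measurable unit_lborel \<and> integrable unit_lborel (\<lambda>s. (norm (f s))\<^sup>2)"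

definition ae_eq :: "(real \<Rightarrow> 'b::euclidean_space) \<Rightarrow> (real \<Rightarrow> 'b) \<Rightarrow> bool"
  where "ae_eq f g \<longleftrightarrow>
    square_integrable f \<and> square_integrable g \<and> (AE s in unit_lborel. f s = g s)"

lemma square_integrable_measurable:
  "square_integrable f \<Longrightarrow> f \<in> borel_measurable unit_lborel"
  by (simp add: square_integrable_def)

lemma square_integrable_zero: "square_integrable (\<lambda>_. 0)"
  by (simp add: square_integrable_def)

lemma square_integrable_add:
  assumes "square_integrable f" "square_integrable g"
  shows "square_integrable (\<lambda>s. f s + g s)"
  unfolding square_integrable_def
proof
  have [measurable]: "f \<in> borel_measurable unit_lborel" "g \<in> borel_measurable unit_lborel"
    using assms by (auto simp: square_integrable_def)
  show "(\<lambda>s. f s + g s) \<in> borel_measurable unit_lborel"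
    by measurable
  have "integrable unit_lborel (\<lambda>s. 2 * (norm (f s))\<^sup>2 + 2 * (norm (g s))\<^sup>2)"
    using assms by (auto simp: square_integrable_def)
  then show "integrable unit_lborel (\<lambda>s. (norm (f s + g s))\<^sup>2)"
  proof (rule Bochner_Integration.integrable_bound)
    have "(norm (f s + g s))\<^sup>2 \<le> 2 * (norm (f s))\<^sup>2 + 2 * (norm (g s))\<^sup>2" for s
    proof -
      have "(norm (f s + g s))\<^sup>2 \<le> (norm (f s) + norm (g s))\<^sup>2"
        by (intro power_mono norm_triangle_ineq) simp
      also have "\<dots> \<le> 2 * (norm (f s))\<^sup>2 + 2 * (norm (g s))\<^sup>2"
        using zero_le_power2[of "norm (f s) - norm (g s)"]
        by (simp add: power2_sum power2_diff)
      finally show ?thesis .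
    qed
    then show "AE s in unit_lborel. norm ((norm (f s + g s))\<^sup>2)
        \<le> norm (2 * (norm (f s))\<^sup>2 + 2 * (norm (g s))\<^sup>2)"
      by (intro AE_I2) (simp add: abs_of_nonneg)
  qed measurable
qed

lemma square_integrable_scaleR:
  assumes "square_integrable f"
  shows "square_integrable (\<lambda>s. c *\<^sub>R f s)"
  using assms by (auto simp: square_integrable_def power_mult_distrib)

lemma square_integrable_uminus: "square_integrable f \<Longrightarrow> square_integrable (\<lambda>s. - f s)"
  using square_integrable_scaleR[of f "-1"] by simp

lemma square_integrable_diff:
  "square_integrable f \<Longrightarrow> square_integrable g \<Longrightarrow> square_integrable (\<lambda>s. f s - g s)"
  using square_integrable_add[of f "\<lambda>s. - g s"] square_integrable_uminus[of g] by simp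

lemma square_integrable_inner:
  assumes "square_integrable f" "square_integrable g"
  shows "integrable unit_lborel (\<lambda>s. f s \<bullet> g s)"
proof -
  have [measurable]: "f \<in> borel_measurable unit_lborel" "g \<in> borel_measurable unit_lborel"
    using assms by (auto simp: square_integrable_def)
  have "integrable unit_lborel (\<lambda>s. (norm (f s))\<^sup>2 + (norm (g s))\<^sup>2)"
    using assms by (auto simp: square_integrable_def)
  then show ?thesis
  proof (rule Bochner_Integration.integrable_bound)
    have "\<bar>f s \<bullet> g s\<bar> \<le> (norm (f s))\<^sup>2 + (norm (g s))\<^sup>2" for s
    proof -
      have "\<bar>f s \<bullet> g s\<bar> \<le> norm (f s) * norm (g s)"
        by (rule Cauchy_Schwarz_ineq2)
      also have "\<dots> \<le> (norm (f s))\<^sup>2 + (norm (g s))\<^sup>2"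
        using zero_le_power2[of "norm (f s) - norm (g s)"]
          mult_nonneg_nonneg[OF norm_ge_zero[of "f s"] norm_ge_zero[of "g s"]]
        unfolding power2_diff by linarith
      finally show ?thesis .
    qed
    then show "AE s in unit_lborel. norm (f s \<bullet> g s) \<le> norm ((norm (f s))\<^sup>2 + (norm (g s))\<^sup>2)"
      by (intro AE_I2) (simp add: abs_of_nonneg)
  qed measurable
qed

quotient_type 'm L2 = "real \<Rightarrow> real ^ 'm::finite" / partial: ae_eq
proof (rule part_equivpI)
  show "\<exists>f :: real \<Rightarrow> real ^ 'm. ae_eq f f"
    using square_integrable_zero by (auto simp: ae_eq_def intro!: exI[of _ "\<lambda>_. 0"])
  show "symp (ae_eq :: (real \<Rightarrow> real ^ 'm) \<Rightarrow> _)"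
    by (auto simp: symp_def ae_eq_def eq_commute)
  show "transp (ae_eq :: (real \<Rightarrow> real ^ 'm) \<Rightarrow> _)"
    by (auto simp: transp_def ae_eq_def)
qed

instantiation L2 :: (finite) real_inner
begin

lift_definition zero_L2 :: "'a L2" is "\<lambda>_. 0"
  by (simp add: ae_eq_def square_integrable_zero)

lift_definition plus_L2 :: "'a L2 \<Rightarrow> 'a L2 \<Rightarrow> 'a L2" is "\<lambda>f g s. f s + g s"
  by (auto simp: ae_eq_def intro: square_integrable_add)

lift_definition minus_L2 :: "'a L2 \<Rightarrow> 'a L2 \<Rightarrow> 'a L2" is "\<lambda>f g s. f s - g s"
  by (auto simp: ae_eq_def intro: square_integrable_diff)

lift_definition uminus_L2 :: "'a L2 \<Rightarrow> 'a L2" is "\<lambda>f s. - f s"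
  by (auto simp: ae_eq_def intro: square_integrable_uminus)

lift_definition scaleR_L2 :: "real \<Rightarrow> 'a L2 \<Rightarrow> 'a L2" is "\<lambda>c f s. c *\<^sub>R f s"
  by (auto simp: ae_eq_def intro: square_integrable_scaleR)

lift_definition inner_L2 :: "'a L2 \<Rightarrow> 'a L2 \<Rightarrow> real"
  is "\<lambda>f g. integral\<^sup>L unit_lborel (\<lambda>s. f s \<bullet> g s)"
  by (rule integral_cong_AE)
    (auto simp: ae_eq_def dest!: square_integrable_measurable intro: borel_measurable_inner)

definition norm_L2 :: "'a L2 \<Rightarrow> real" where "norm_L2 x = sqrt (x \<bullet> x)"
definition dist_L2 :: "'a L2 \<Rightarrow> 'a L2 \<Rightarrow> real" where "dist_L2 x y = norm (x - y)"
definition sgn_L2 :: "'a L2 \<Rightarrow> 'a L2" where "sgn_L2 x = inverse (norm x) *\<^sub>R x"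

definition uniformity_L2 :: "('a L2 \<times> 'a L2) filter"
  where "uniformity_L2 = (INF e\<in>{0<..}. principal {(x, y). dist x y < e})"

definition open_L2 :: "'a L2 set \<Rightarrow> bool"
  where "open_L2 U \<longleftrightarrow> (\<forall>x\<in>U. eventually (\<lambda>(x', y). x' = x \<longrightarrow> y \<in> U) uniformity)"

instance
proof
  fix x y z :: "'a L2" and a b r :: real
  show "x + y + z = x + (y + z)"
    by transfer (simp add: ae_eq_def square_integrable_add add.assoc)
  show "x + y = y + x"
    by transfer (simp add: ae_eq_def square_integrable_add add.commute)
  show "0 + x = x"
    by transfer (simp add: ae_eq_def)
  show "- x + x = 0"
    by transfer (simp add: ae_eq_def square_integrable_zero)
  show "x - y = x + - y"
    by transfer (simp add: ae_eq_def square_integrable_diff)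
  show "a *\<^sub>R (x + y) = a *\<^sub>R x + a *\<^sub>R y"
    by transfer (simp add: ae_eq_def square_integrable_add square_integrable_scaleR scaleR_right_distrib)
  show "(a + b) *\<^sub>R x = a *\<^sub>R x + b *\<^sub>R x"
    by transfer (simp add: ae_eq_def square_integrable_add square_integrable_scaleR scaleR_left_distrib)
  show "a *\<^sub>R b *\<^sub>R x = (a * b) *\<^sub>R x"
    by transfer (simp add: ae_eq_def square_integrable_scaleR)
  show "1 *\<^sub>R x = x"
    by transfer (simp add: ae_eq_def)
  show "dist x y = norm (x - y)" by (rule dist_L2_def)
  show "sgn x = inverse (norm x) *\<^sub>R x" by (rule sgn_L2_def)
  show "(uniformity :: ('a L2 \<times> 'a L2) filter) = (INF e\<in>{0<..}. principal {(x, y). dist x y < e})"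
    by (rule uniformity_L2_def)
  show "open U \<longleftrightarrow> (\<forall>x\<in>U. eventually (\<lambda>(x', y). x' = x \<longrightarrow> y \<in> U) uniformity)" for U :: "'a L2 set"
    by (rule open_L2_def)
  show "norm x = sqrt (x \<bullet> x)" by (rule norm_L2_def)
  show "x \<bullet> y = y \<bullet> x"
    by transfer (simp add: inner_commute)
  show "(x + y) \<bullet> z = x \<bullet> z + y \<bullet> z"
    by transfer (simp add: ae_eq_def inner_add_left square_integrable_inner)
  show "(r *\<^sub>R x) \<bullet> y = r * (x \<bullet> y)"
    by transfer simp
  show "0 \<le> x \<bullet> x"
    by transfer simp
  show "x \<bullet> x = 0 \<longleftrightarrow> x = 0"
  proof transfer
    fix f :: "real \<Rightarrow> real ^ 'a"
    assume "ae_eq f f"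
    then have f: "square_integrable f" by (simp add: ae_eq_def)
    have "integral\<^sup>L unit_lborel (\<lambda>s. f s \<bullet> f s) = 0 \<longleftrightarrow> (AE s in unit_lborel. f s \<bullet> f s = 0)"
      by (rule integral_nonneg_eq_0_iff_AE) (auto simp: square_integrable_inner f)
    then show "integral\<^sup>L unit_lborel (\<lambda>s. f s \<bullet> f s) = 0 \<longleftrightarrow> ae_eq f (\<lambda>_. 0)"
      by (simp add: ae_eq_def f square_integrable_zero)
  qed
qed

end

text \<open>
  The matrix norm below is the Frobenius norm; in finite dimensions the choice of norm does not
  affect membership.
\<close>

definition Linf_multiplier :: "(real \<Rightarrow> real ^ 'm ^ 'm) \<Rightarrow> bool"
  where "Linf_multiplier R \<longleftrightarrow>
    R \<in> borel_measurable unit_lborel \<and> (\<exists>c. AE s in unit_lborel. norm (R s) \<le> c)"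

definition L2_kernel :: "(real \<Rightarrow> real \<Rightarrow> real ^ 'm ^ 'm) \<Rightarrow> bool"
  where "L2_kernel R \<longleftrightarrow>
    case_prod R \<in> borel_measurable (unit_lborel \<Otimes>\<^sub>M unit_lborel) \<and>
    integrable (unit_lborel \<Otimes>\<^sub>M unit_lborel) (\<lambda>(s, \<theta>). (norm (R s \<theta>))\<^sup>2)"

text \<open>
  \<open>rep_L2\<close> picks some representative; the condition is independent of that choice,
  since changing \<open>x\<close> on a null set changes neither integral, and changes the first
  summand only on a null set, while \<open>P x\<close> enters only up to null sets.
\<close>

definition PI_operators :: "('m::finite L2 \<Rightarrow> 'm L2) set"  (\<open>\<Pi>\<^sub>3\<close>)
  where "\<Pi>\<^sub>3 = {P. bounded_linear P \<and>
    (\<exists>R\<^sub>0 R\<^sub>1 R\<^sub>2. Linf_multiplier R\<^sub>0 \<and> L2_kernel R\<^sub>1 \<and> L2_kernel R\<^sub>2 \<and>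
      (\<forall>x. AE s in unit_lborel. rep_L2 (P x) s =
          R\<^sub>0 s *v rep_L2 x s
          + (LBINT \<theta>:{0..s}. R\<^sub>1 s \<theta> *v rep_L2 x \<theta>)
          + (LBINT \<theta>:{s..1}. R\<^sub>2 s \<theta> *v rep_L2 x \<theta>)))}"

text \<open>
  Trajectories are functions on the reals of which only the restriction to \<open>{0..}\<close> matters;
  the derivative at time 0 is one-sided.
\<close>

definition PIE_solution ::
    "('m::finite L2 \<Rightarrow> 'm L2) \<Rightarrow> ('m L2 \<Rightarrow> 'm L2) \<Rightarrow> (real \<Rightarrow> 'm L2) \<Rightarrow> bool"
  where "PIE_solution T A x \<longleftrightarrow>
    (\<forall>t\<ge>0. \<exists>x'. (x has_vector_derivative x') (at t within {0..}) \<and> T x' = A (x t))"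

definition continuous_along_solutions ::
    "('m::finite L2 \<Rightarrow> 'm L2) \<Rightarrow> ('m L2 \<Rightarrow> 'm L2) \<Rightarrow> ('m L2 \<Rightarrow> real) \<Rightarrow> bool"
  where "continuous_along_solutions T A V \<longleftrightarrow>
    (\<forall>x. PIE_solution T A x \<longrightarrow> continuous_on {0..} (\<lambda>t. V (x t)))"

definition derivative_along_solutions ::
    "('m::finite L2 \<Rightarrow> 'm L2) \<Rightarrow> ('m L2 \<Rightarrow> 'm L2) \<Rightarrow> ('m L2 \<Rightarrow> real) \<Rightarrow> ('m L2 \<Rightarrow> real) \<Rightarrow> bool"
  where "derivative_along_solutions T A V V' \<longleftrightarrow>
    (\<forall>x x\<^sub>s. PIE_solution T A x\<^sub>s \<and> x\<^sub>s 0 = x \<longrightarrow>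
      ((\<lambda>h. (V (x\<^sub>s h) - V x) / h) \<longlongrightarrow> V' x) (at_right 0))"

definition PIE_bounded :: "('m::finite L2 \<Rightarrow> real) \<Rightarrow> bool"
  where "PIE_bounded V \<longleftrightarrow> (\<exists>C>0. \<forall>x. V x \<le> C * (norm x)\<^sup>2)"

definition PDE_bounded :: "('m::finite L2 \<Rightarrow> 'm L2) \<Rightarrow> ('m L2 \<Rightarrow> real) \<Rightarrow> bool"
  where "PDE_bounded T V \<longleftrightarrow> (\<exists>C>0. \<forall>x. V x \<le> C * (norm (T x))\<^sup>2)"

definition PIE_negative :: "('m::finite L2 \<Rightarrow> real) \<Rightarrow> bool"
  where "PIE_negative V' \<longleftrightarrow> (\<exists>\<alpha>>0. \<forall>x. V' x \<le> - \<alpha> * (norm x)\<^sup>2)"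

definition PDE_negative :: "('m::finite L2 \<Rightarrow> 'm L2) \<Rightarrow> ('m L2 \<Rightarrow> real) \<Rightarrow> bool"
  where "PDE_negative T V' \<longleftrightarrow> (\<exists>\<alpha>>0. \<forall>x. V' x \<le> - \<alpha> * (norm (T x))\<^sup>2)"

text \<open>
  The Bochner integral of a non-integrable function is 0, so finiteness of the energy has to be
  required explicitly for the inequality to have its intended meaning.
\<close>

definition energy_le :: "(real \<Rightarrow> 'a::real_normed_vector) \<Rightarrow> real \<Rightarrow> bool"
  where "energy_le y b \<longleftrightarrow>
    set_integrable lborel {0..} (\<lambda>t. (norm (y t))\<^sup>2) \<and>
    sqrt (LBINT t:{0..}. (norm (y t))\<^sup>2) \<le> b"

definition FE_PIE_to_PDE_stable :: "('m::finite L2 \<Rightarrow> 'm L2) \<Rightarrow> ('m L2 \<Rightarrow> 'm L2) \<Rightarrow> bool"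
  where "FE_PIE_to_PDE_stable T A \<longleftrightarrow>
    (\<exists>C>0. \<forall>x. PIE_solution T A x \<longrightarrow> energy_le (\<lambda>t. T (x t)) (C * norm (x 0)))"

definition FE_PIE_stable :: "('m::finite L2 \<Rightarrow> 'm L2) \<Rightarrow> ('m L2 \<Rightarrow> 'm L2) \<Rightarrow> bool"
  where "FE_PIE_stable T A \<longleftrightarrow>
    (\<exists>C>0. \<forall>x. PIE_solution T A x \<longrightarrow> energy_le x (C * norm (x 0)))"

definition FE_PDE_stable :: "('m::finite L2 \<Rightarrow> 'm L2) \<Rightarrow> ('m L2 \<Rightarrow> 'm L2) \<Rightarrow> bool"
  where "FE_PDE_stable T A \<longleftrightarrow>
    (\<exists>C>0. \<forall>x. PIE_solution T A x \<longrightarrow> energy_le (\<lambda>t. T (x t)) (C * norm (T (x 0))))"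

definition FE_PDE_to_PIE_stable :: "('m::finite L2 \<Rightarrow> 'm L2) \<Rightarrow> ('m L2 \<Rightarrow> 'm L2) \<Rightarrow> bool"
  where "FE_PDE_to_PIE_stable T A \<longleftrightarrow>
    (\<exists>C>0. \<forall>x. PIE_solution T A x \<longrightarrow> energy_le x (C * norm (T (x 0))))"

end

theory Submission
  imports Defs
begin

text \<open>
  All four claims are instances of one dissipation inequality. Along a solution \<open>x\<close> put
  \<open>v t = V (x t)\<close>, and let \<open>W\<close> be \<open>T\<close> or the identity, according to the
  norm in which \<open>V'\<close> is negative. Because the equation is autonomous, every time shift
  of a solution is a solution, so the defining property of \<open>V'\<close>, which speaks about time 0
  only, says that \<open>v\<close> has at each time \<open>t\<close> the right derivative
  \<open>V' (x t) \<le> - \<alpha> * (norm (W (x t)))\<^sup>2\<close>. Hence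
  \<open>v t + \<alpha> * integral {0..t} (\<lambda>s. (norm (W (x s)))\<^sup>2)\<close> is a continuous
  function of \<open>t\<close> with nonpositive right derivatives, and so it is nonincreasing
  (\<open>right_derivatives_nonpos_imp_le\<close>). As \<open>v \<ge> 0\<close>, the integrals up to
  time \<open>t\<close> are at most \<open>v 0 / \<alpha>\<close>, and monotone convergence carries the bound to
  the half line. Finally \<open>v 0 \<le> C * (norm (U (x 0)))\<^sup>2\<close>, where \<open>U\<close> is the
  identity or \<open>T\<close> according to how \<open>V\<close> is bounded, so the energy bound holds
  with constant \<open>sqrt (C / \<alpha>)\<close>.
\<close>

text \<open>
  The mean value theorem does not apply, since two-sided derivatives need not exist. Tilt the
  function to \<open>h t = f t - e * (t - a)\<close>, whose right derivatives are strictly negative. The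
  last point \<open>s\<close> with \<open>h s \<le> h a\<close> must be \<open>b\<close>: to the right of an earlier
  one, \<open>h\<close> would decrease and stay below \<open>h a\<close> for a while.
\<close>

lemma right_derivatives_nonpos_imp_le:
  fixes f :: "real \<Rightarrow> real"
  assumes "a \<le> b" and cont: "continuous_on {a..b} f"
    and deriv: "\<And>t. a \<le> t \<Longrightarrow> t < b \<Longrightarrow>
      \<exists>D\<le>0. (f has_real_derivative D) (at_right t)"
  shows "f b \<le> f a"
proof (rule field_le_epsilon)
  fix \<epsilon> :: real
  assume "\<epsilon> > 0"
  \<comment> \<open>The tilt costs at most \<open>\<epsilon>\<close> over the interval; the summand 1 covers the case \<open>a = b\<close>.\<close>
  define e where "e = \<epsilon> / (b - a + 1)"
  have "e > 0" and e_le: "e * (b - a) \<le> \<epsilon>"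
    using \<open>\<epsilon> > 0\<close> \<open>a \<le> b\<close> by (auto simp: e_def field_simps)
  define h where "h = (\<lambda>t. f t - e * (t - a))"
  define S where "S = {t \<in> {a..b}. h t \<le> h a}"
  have "continuous_on {a..b} h"
    unfolding h_def by (intro continuous_intros cont)
  then have "closed S"
    unfolding S_def by (intro continuous_on_closed_Collect_le) auto
  have "a \<in> S" and "bdd_above S"
    using \<open>a \<le> b\<close> by (auto simp: S_def intro: bdd_aboveI[of _ b])
  define s where "s = Sup S"
  have "s \<in> S"
    unfolding s_def using \<open>closed S\<close> \<open>a \<in> S\<close> \<open>bdd_above S\<close>
    by (intro closed_contains_Sup) auto
  have "s = b"
  proof (rule ccontr)
    assume "s \<noteq> b"
    with \<open>s \<in> S\<close> have s: "a \<le> s" "s < b" "h s \<le> h a"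
      by (auto simp: S_def)
    obtain D where "D \<le> 0" and D: "(f has_real_derivative D) (at_right s)"
      using deriv s by blast
    have "(h has_real_derivative D - e) (at_right s)"
      unfolding h_def by (rule derivative_eq_intros D refl | simp)+
    moreover have "D - e < 0"
      using \<open>D \<le> 0\<close> \<open>e > 0\<close> by simp
    ultimately obtain d where "d > 0"
      and d: "\<And>k. k > 0 \<Longrightarrow> s + k \<in> {s<..} \<Longrightarrow> k < d \<Longrightarrow> h (s + k) < h s"
      using has_real_derivative_neg_dec_right by blast
    define k where "k = min (d / 2) (b - s)"
    have k: "k > 0" "k < d" "s + k \<le> b"
      using \<open>d > 0\<close> s by (auto simp: k_def)
    then have "s + k \<in> S"
      using d[of k] s by (auto simp: S_def)
    then have "s + k \<le> s"
      unfolding s_def using \<open>bdd_above S\<close> by (rule cSup_upper)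
    with \<open>k > 0\<close> show False by simp
  qed
  with \<open>s \<in> S\<close> have "h b \<le> h a"
    by (simp add: S_def)
  with e_le show "f b \<le> f a + \<epsilon>"
    by (simp add: h_def)
qed

lemma bounded_integrals_imp_integrable_half_line:
  fixes g :: "real \<Rightarrow> real"
  assumes cont: "continuous_on {0..} g"
    and nonneg: "\<And>t. 0 \<le> t \<Longrightarrow> 0 \<le> g t"
    and bound: "\<And>t. 0 \<le> t \<Longrightarrow> integral {0..t} g \<le> B"
  shows "set_integrable lborel {0..} g" and "(LBINT t:{0..}. g t) \<le> B"
proof -
  define G where "G = (\<lambda>(n::nat) t. indicator {0..real n} t *\<^sub>R g t)"
  have cont_Icc: "continuous_on {0..t} g" for t
    using cont by (rule continuous_on_subset) auto
  have int: "integrable lborel (G n)" for n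
    using borel_integrable_atLeastAtMost'[OF cont_Icc[of "real n"]]
    by (simp add: G_def set_integrable_def)
  have le: "integral\<^sup>L lborel (G n) \<le> B" for n
    using set_borel_integral_eq_integral(2)[OF borel_integrable_atLeastAtMost'[OF cont_Icc[of "real n"]]]
      bound[of "real n"]
    by (simp add: G_def set_lebesgue_integral_def)
  have mono: "G m t \<le> G n t" if "m \<le> n" for m n t
    using that nonneg by (auto simp: G_def indicator_def)
  have "incseq (\<lambda>n. integral\<^sup>L lborel (G n))"
    by (intro monoI integral_mono int mono)
  then obtain L where L: "(\<lambda>n. integral\<^sup>L lborel (G n)) \<longlonglongrightarrow> L"
    using incseq_convergent[of _ B] le by metis
  have lim: "(\<lambda>n. G n t) \<longlonglongrightarrow> indicator {0..} t *\<^sub>R g t" for t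
  proof (rule tendsto_eventually)
    obtain N :: nat where "t \<le> real N"
      using real_arch_simple by blast
    then show "\<forall>\<^sub>F n in sequentially. G n t = indicator {0..} t *\<^sub>R g t"
      by (intro eventually_sequentiallyI[of N]) (auto simp: G_def indicator_def)
  qed
  have meas: "(\<lambda>t. indicator {0..} t *\<^sub>R g t) \<in> borel_measurable lborel"
    using borel_measurable_continuous_on_indicator[OF _ cont] by simp
  have AE_mono: "AE t in lborel. mono (\<lambda>n. G n t)"
    by (intro AE_I2 monoI mono)
  have AE_lim: "AE t in lborel. (\<lambda>n. G n t) \<longlonglongrightarrow> indicator {0..} t *\<^sub>R g t"
    by (intro AE_I2 lim)
  show "set_integrable lborel {0..} g"
    unfolding set_integrable_def
    by (rule integrable_monotone_convergence[OF int AE_mono AE_lim L meas])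
  have "(LBINT t:{0..}. g t) = L"
    unfolding set_lebesgue_integral_def
    by (rule integral_monotone_convergence[OF int AE_mono AE_lim L meas])
  also have "L \<le> B"
    using L le by (intro LIMSEQ_le_const2) auto
  finally show "(LBINT t:{0..}. g t) \<le> B" .
qed

text \<open>
  The function \<open>v\<close> is a storage that loses at least \<open>\<alpha>\<close> times the current power of
  \<open>y\<close>. Since it starts at \<open>v 0\<close> and never becomes negative, the total energy it can
  pay for is \<open>v 0 / \<alpha>\<close>.
\<close>

lemma dissipation_imp_energy_le:
  fixes y :: "real \<Rightarrow> 'a::real_normed_vector" and v :: "real \<Rightarrow> real"
  assumes "\<alpha> > 0"
    and cont_y: "continuous_on {0..} y" and cont_v: "continuous_on {0..} v"
    and nonneg: "\<And>t. 0 \<le> t \<Longrightarrow> 0 \<le> v t"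
    and deriv: "\<And>t. 0 \<le> t \<Longrightarrow>
      \<exists>D \<le> - \<alpha> * (norm (y t))\<^sup>2. (v has_real_derivative D) (at_right t)"
  shows "energy_le y (sqrt (v 0 / \<alpha>))"
proof -
  define g where "g = (\<lambda>t. (norm (y t))\<^sup>2)"
  have cont_g: "continuous_on {0..} g"
    unfolding g_def by (intro continuous_intros cont_y)
  have "integral {0..b} g \<le> v 0 / \<alpha>" if "0 \<le> b" for b
  proof -
    define \<phi> where "\<phi> = (\<lambda>t. v t + \<alpha> * integral {0..t} g)"
    have cont_g': "continuous_on {0..b} g"
      using cont_g by (rule continuous_on_subset) auto
    have "\<phi> b \<le> \<phi> 0"
    proof (rule right_derivatives_nonpos_imp_le[OF that])
      show "continuous_on {0..b} \<phi>"
        unfolding \<phi>_def using cont_g'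
        by (intro continuous_intros continuous_on_subset[OF cont_v] indefinite_integral_continuous_1
            integrable_continuous_real) auto
    next
      fix t
      assume t: "0 \<le> t" "t < b"
      obtain D where "D \<le> - \<alpha> * g t" and D: "(v has_real_derivative D) (at_right t)"
        using deriv[OF t(1)] by (auto simp: g_def)
      have "((\<lambda>u. integral {0..u} g) has_real_derivative g t) (at t within {0..b})"
        using integral_has_vector_derivative[OF cont_g', of t] t
        by (simp add: has_real_derivative_iff_has_vector_derivative)
      then have "((\<lambda>u. integral {0..u} g) has_real_derivative g t) (at t within {t..b})"
        by (rule DERIV_subset) (use t in auto)
      then have I: "((\<lambda>u. integral {0..u} g) has_real_derivative g t) (at_right t)"
        using t by (simp add: at_within_Icc_at_right)
      have "(\<phi> has_real_derivative D + \<alpha> * g t) (at_right t)"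
        unfolding \<phi>_def by (rule derivative_eq_intros D I refl | simp)+
      with \<open>D \<le> - \<alpha> * g t\<close> show "\<exists>D\<le>0. (\<phi> has_real_derivative D) (at_right t)"
        by (intro exI[of _ "D + \<alpha> * g t"]) auto
    qed
    then have "\<alpha> * integral {0..b} g \<le> v 0"
      using nonneg[OF that] by (simp add: \<phi>_def)
    with \<open>\<alpha> > 0\<close> show ?thesis
      by (simp add: field_simps)
  qed
  note bound = bounded_integrals_imp_integrable_half_line[OF cont_g _ this]
  have "set_integrable lborel {0..} g" and "(LBINT t:{0..}. g t) \<le> v 0 / \<alpha>"
    by (rule bound; simp add: g_def)+
  then show ?thesis
    by (simp add: energy_le_def g_def)
qed

text \<open>
  The equation does not mention time. The shift has to go forward, so that the shifted function
  still solves the equation on the whole half line.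
\<close>

lemma PIE_solution_shift:
  assumes sol: "PIE_solution T A x" and "0 \<le> c"
  shows "PIE_solution T A (\<lambda>t. x (c + t))"
  unfolding PIE_solution_def
proof (intro allI impI)
  fix t :: real
  assume "0 \<le> t"
  with sol \<open>0 \<le> c\<close> obtain x' where x': "(x has_vector_derivative x') (at (c + t) within {0..})"
    and eq: "T x' = A (x (c + t))"
    unfolding PIE_solution_def by (meson add_nonneg_nonneg)
  have "((+) c has_vector_derivative 1) (at t within {0..})"
    by (rule derivative_eq_intros refl | simp)+
  moreover have "(x has_vector_derivative x') (at (c + t) within (+) c ` {0..})"
    using x' by (rule has_vector_derivative_within_subset) (use \<open>0 \<le> c\<close> in auto)
  ultimately have "(x \<circ> (+) c has_vector_derivative 1 *\<^sub>R x') (at t within {0..})"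
    by (rule vector_diff_chain_within)
  with eq show "\<exists>x'. ((\<lambda>t. x (c + t)) has_vector_derivative x') (at t within {0..})
      \<and> T x' = A (x (c + t))"
    by (auto simp: o_def)
qed

lemma continuous_on_PIE_solution:
  assumes "PIE_solution T A x"
  shows "continuous_on {0..} x"
  using assms unfolding PIE_solution_def continuous_on_eq_continuous_within
  by (meson atLeast_iff has_vector_derivative_continuous)

lemma has_right_derivative_along_solution:
  assumes "derivative_along_solutions T A V V'" and "PIE_solution T A x" and "0 \<le> t"
  shows "((\<lambda>s. V (x s)) has_real_derivative V' (x t)) (at_right t)"
proof -
  have "PIE_solution T A (\<lambda>h. x (t + h))"
    using assms(2,3) by (rule PIE_solution_shift)
  then have "((\<lambda>h. (V (x (t + h)) - V (x t)) / h) \<longlongrightarrow> V' (x t)) (at_right 0)"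
    using assms(1) by (force simp: derivative_along_solutions_def)
  then show ?thesis
    unfolding has_field_derivative_iff filterlim_at_right_to_0[of _ _ t]
    by (simp add: add.commute)
qed

text \<open>
  Each of the four stability notions is this statement for a choice of \<open>T\<close> or the identity
  for the measured output \<open>W\<close> and for the initial quantity \<open>U\<close>.
\<close>

lemma finite_energy_bound:
  fixes W :: "'m::finite L2 \<Rightarrow> 'b::real_normed_vector"
    and U :: "'m L2 \<Rightarrow> 'c::real_normed_vector"
  assumes nonneg: "\<And>x. V x \<ge> 0"
    and cont: "continuous_along_solutions T A V"
    and deriv: "derivative_along_solutions T A V V'"
    and W: "bounded_linear W"
    and bounded: "\<exists>C>0. \<forall>x. V x \<le> C * (norm (U x))\<^sup>2"
    and negative: "\<exists>\<alpha>>0. \<forall>x. V' x \<le> - \<alpha> * (norm (W x))\<^sup>2"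
  shows "\<exists>K>0. \<forall>x. PIE_solution T A x \<longrightarrow>
    energy_le (\<lambda>t. W (x t)) (K * norm (U (x 0)))"
proof -
  obtain C where "C > 0" and C: "\<And>x. V x \<le> C * (norm (U x))\<^sup>2"
    using bounded by blast
  obtain \<alpha> where "\<alpha> > 0" and \<alpha>: "\<And>x. V' x \<le> - \<alpha> * (norm (W x))\<^sup>2"
    using negative by blast
  have "energy_le (\<lambda>t. W (x t)) (sqrt (C / \<alpha>) * norm (U (x 0)))"
    if sol: "PIE_solution T A x" for x
  proof -
    have "energy_le (\<lambda>t. W (x t)) (sqrt (V (x 0) / \<alpha>))"
    proof (rule dissipation_imp_energy_le[OF \<open>\<alpha> > 0\<close>])
      show "continuous_on {0..} (\<lambda>t. W (x t))"
        using W continuous_on_PIE_solution[OF sol] by (rule bounded_linear.continuous_on)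
      show "continuous_on {0..} (\<lambda>t. V (x t))"
        using cont sol by (simp add: continuous_along_solutions_def)
      show "\<exists>D \<le> - \<alpha> * (norm (W (x t)))\<^sup>2.
          ((\<lambda>t. V (x t)) has_real_derivative D) (at_right t)" if "0 \<le> t" for t
        using \<alpha> has_right_derivative_along_solution[OF deriv sol that] by blast
    qed (rule nonneg)
    moreover have "sqrt (V (x 0) / \<alpha>) \<le> sqrt (C / \<alpha>) * norm (U (x 0))"
    proof -
      have "sqrt (V (x 0) / \<alpha>) \<le> sqrt (C / \<alpha> * (norm (U (x 0)))\<^sup>2)"
        using divide_right_mono[OF C[of "x 0"], of \<alpha>] \<open>\<alpha> > 0\<close> by (intro real_sqrt_le_mono) simp
      then show ?thesis
        by (simp only: real_sqrt_mult real_sqrt_abs abs_norm_cancel)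
    qed
    ultimately show ?thesis
      unfolding energy_le_def by (blast intro: order_trans)
  qed
  with \<open>C > 0\<close> \<open>\<alpha> > 0\<close> show ?thesis
    by (intro exI[of _ "sqrt (C / \<alpha>)"]) auto
qed

theorem lemma5:
  fixes T A :: "'m::finite L2 \<Rightarrow> 'm L2"
    and V V' :: "'m L2 \<Rightarrow> real"
  assumes "T \<in> \<Pi>\<^sub>3" and "A \<in> \<Pi>\<^sub>3"
    and "\<And>x. V x \<ge> 0" and "V 0 = 0"
    and "continuous_along_solutions T A V"
    and "derivative_along_solutions T A V V'"
  shows "(PIE_bounded V \<and> PDE_negative T V' \<longrightarrow> FE_PIE_to_PDE_stable T A) \<and>
    (PIE_bounded V \<and> PIE_negative V' \<longrightarrow> FE_PIE_stable T A) \<and>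
    (PDE_bounded T V \<and> PDE_negative T V' \<longrightarrow> FE_PDE_stable T A) \<and>
    (PDE_bounded T V \<and> PIE_negative V' \<longrightarrow> FE_PDE_to_PIE_stable T A)"
proof -
  have T: "bounded_linear T"
    using assms(1) by (simp add: PI_operators_def)
  note bound_T = finite_energy_bound[OF assms(3,5,6) T]
    and bound_id = finite_energy_bound[OF assms(3,5,6) bounded_linear_ident]
  show ?thesis
    unfolding PIE_bounded_def PDE_bounded_def PIE_negative_def PDE_negative_def
      FE_PIE_to_PDE_stable_def FE_PIE_stable_def FE_PDE_stable_def FE_PDE_to_PIE_stable_def
    using bound_T[of "\<lambda>x. x"] bound_T[of T] bound_id[of "\<lambda>x. x"] bound_id[of T]
    by blast
qed

end
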